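(* Let $\rho>0$. There is an algorithm which, whenever the problem P$^{\max}_{\text{no return}}$ is feasible, computes in time $O\left(S\log\frac{1}{\rho}\right)$ a feasible solution $(\boldsymbol{d},\boldsymbol{y})$ of P$^{\max}_{\text{no return}}$ satisfying $g^{\max}(\boldsymbol{d},\boldsymbol{y})\leq OPT+\rho$, where $OPT$ is the optimal value of P$^{\max}_{\text{no return}}$.
   Context: Data: a positive integer $S$ (number of shuttles), a capacity $C\geq 0$, a period length $T$, a loading rate $\nu\geq 0$, and a nondecreasing upper semicontinuous function $D:[0,T]\to\mathbb{R}_+$ with $D(T)>0$ (cumulative demand). Pseudo-inverses of $D$: for $y\in[0,D(T)]$, $\tau(y)=\inf\{t\in[0,T]: D(t)>y\}$ if $y<D(T)$ and $\tau(D(T))=T$; $\bar\tau(y)=\inf\{t\in[0,T]: D(t)\geq y\}$. Problem P$^{\max}_{\text{no return}}$: over nonnegative reals $\boldsymbol d=(d_1,\dots,d_S)$, $\boldsymbol y=(y_1,\dots,y_S)$, with $y_0=0$, minimize $$g^{\max}(\boldsymbol d,\boldsymbol y)=\max_{j:\,y_j>y_{j-1}}\big(d_j-\tau(y_{j-1})\big)$$ subject to: (i) $y_j-y_{j-1}\leq C$ for $j=1,\dots,S$; (ii) $y_{j-1}\leq y_j$ for $j=1,\dots,S$; (iii) $d_{j-1}\leq d_j$ for $j=2,\dots,S$; (iv) $y_S=D(T)$; (v) $\bar\tau(y_j)+\nu(y_j-y_{j-1})\leq d_j$ for $j=1,\dots,S$. Computational model: the following operations take constant time: evaluation of $D(t)$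 for any $t\in[0,T]$; integration of $D$ between two values; evaluation of $\tau(y)$ and $\bar\tau(y)$ for any $y$; evaluation of $\sup\{y:\bar\tau(y)+\nu y\leq\alpha\}$ for any $\alpha\in\mathbb{R}_+$. The quantities $C$, $T$, $D(\cdot)$, $\nu$ are constants of the computational model (the constants hidden in the $O$-notation may depend on them); complexities are expressed in terms of $S$ and the accuracy. *)

theory Defs
  imports "HOL-Analysis.Analysis"
begin

section \<open>The shuttle problem without return\<close>

record shuttle =
  capacity :: real
  period :: real
  rate :: real
  demand :: "real \<Rightarrow> real"

definition usc_on :: "real set \<Rightarrow> (real \<Rightarrow> real) \<Rightarrow> bool" where
  "usc_on A f \<longleftrightarrow> (\<forall>a\<in>A. \<forall>z>f a. \<forall>\<^sub>F x in at a within A. f x < z)"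

text \<open>The demand is a function on the interval from 0 to the period; its values
  elsewhere are unconstrained and are used nowhere below.\<close>

definition shuttle_data :: "shuttle \<Rightarrow> bool" where
  "shuttle_data P \<longleftrightarrow>
     0 \<le> capacity P \<and> 0 \<le> period P \<and> 0 \<le> rate P \<and>
     (\<forall>t\<in>{0..period P}. 0 \<le> demand P t) \<and>
     mono_on {0..period P} (demand P) \<and>
     usc_on {0..period P} (demand P) \<and>
     0 < demand P (period P)"

abbreviation total_demand :: "shuttle \<Rightarrow> real" where
  "total_demand P \<equiv> demand P (period P)"

text \<open>Both pseudo-inverses are meant for arguments between 0 and the total demand.\<close>

definition tau :: "shuttle \<Rightarrow> real \<Rightarrow> real" where
  "tau P y = (if y < total_demand P then Inf {t \<in> {0..period P}. y < demand P t} else period P)"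

definition tau_bar :: "shuttle \<Rightarrow> real \<Rightarrow> real" where
  "tau_bar P y = Inf {t \<in> {0..period P}. y \<le> demand P t}"

text \<open>A vector indexed by \<open>1..S\<close> is a function on the naturals of which only these
  values matter; in addition \<open>y 0\<close> is the convention \<open>y 0 = 0\<close> of the problem.\<close>

definition feasible :: "shuttle \<Rightarrow> nat \<Rightarrow> (nat \<Rightarrow> real) \<Rightarrow> (nat \<Rightarrow> real) \<Rightarrow> bool" where
  "feasible P S d y \<longleftrightarrow>
     (\<forall>j\<in>{1..S}. 0 \<le> d j \<and> 0 \<le> y j) \<and> y 0 = 0 \<and>
     (\<forall>j\<in>{1..S}. y j - y (j - 1) \<le> capacity P) \<and>
     (\<forall>j\<in>{1..S}. y (j - 1) \<le> y j) \<and>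
     (\<forall>j\<in>{2..S}. d (j - 1) \<le> d j) \<and>
     y S = total_demand P \<and>
     (\<forall>j\<in>{1..S}. tau_bar P (y j) + rate P * (y j - y (j - 1)) \<le> d j)"

text \<open>For feasible points the maximum is over a nonempty set, since
  \<open>y S = total_demand P > 0 = y 0\<close>.\<close>

definition gmax :: "shuttle \<Rightarrow> nat \<Rightarrow> (nat \<Rightarrow> real) \<Rightarrow> (nat \<Rightarrow> real) \<Rightarrow> real" where
  "gmax P S d y = Max ((\<lambda>j. d j - tau P (y (j - 1))) ` {j \<in> {1..S}. y (j - 1) < y j})"

definition OPT :: "shuttle \<Rightarrow> nat \<Rightarrow> real" where
  "OPT P S = Inf {gmax P S d y | d y. feasible P S d y}"

text \<open>The objective is bounded below, so this infimum is a genuine one whenever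
  the problem is feasible.\<close>

lemma gmax_nonneg:
  assumes P: "shuttle_data P" and F: "feasible P S d y"
  shows "0 \<le> gmax P S d y"
proof -
  let ?J = "{j \<in> {1..S}. y (j - 1) < y j}"
  have "?J \<noteq> {}"
  proof
    assume "?J = {}"
    then have le: "y j \<le> y (j - 1)" if "j \<in> {1..S}" for j
      using that by force
    have "j \<le> S \<Longrightarrow> y j \<le> 0" for j
    proof (induction j)
      case 0
      then show ?case using F by (simp add: feasible_def)
    next
      case (Suc j)
      then show ?case using le[of "Suc j"] by simp
    qed
    from this[of S] show False
      using P F by (simp add: feasible_def shuttle_data_def)
  qed
  then obtain j where j: "j \<in> ?J" by blast
  have y_le: "y i \<le> y S" if "i \<le> S" for i
    using that
  proof (induction i rule: inc_induct)
    case base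
    then show ?case by simp
  next
    case (step i)
    have "y (Suc i - 1) \<le> y (Suc i)"
      using F step.hyps unfolding feasible_def by (metis Suc_leI atLeastAtMost_iff le_add1 plus_1_eq_Suc)
    with step show ?case by simp
  qed
  have yS: "y S = total_demand P" using F by (simp add: feasible_def)
  have lt: "y (j - 1) < total_demand P" using j y_le[of j] yS by simp
  have T: "0 \<le> period P" using P by (simp add: shuttle_data_def)
  have "tau P (y (j - 1)) = Inf {t \<in> {0..period P}. y (j - 1) < demand P t}"
    using lt by (simp add: tau_def)
  also have "\<dots> \<le> Inf {t \<in> {0..period P}. y j \<le> demand P t}"
  proof (rule cInf_superset_mono)
    show "{t \<in> {0..period P}. y j \<le> demand P t} \<noteq> {}"
      using T y_le[of j] yS j by auto
    show "bdd_below {t \<in> {0..period P}. y (j - 1) < demand P t}"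
      by (rule bdd_belowI[of _ 0]) simp
    show "{t \<in> {0..period P}. y j \<le> demand P t} \<subseteq> {t \<in> {0..period P}. y (j - 1) < demand P t}"
      using j by auto
  qed
  also have "\<dots> = tau_bar P (y j)" by (simp add: tau_bar_def)
  also have "tau_bar P (y j) \<le> tau_bar P (y j) + rate P * (y j - y (j - 1))"
    using P j by (simp add: shuttle_data_def)
  also have "\<dots> \<le> d j" using F j by (simp add: feasible_def)
  finally have "0 \<le> d j - tau P (y (j - 1))" by simp
  also have "\<dots> \<le> gmax P S d y"
    unfolding gmax_def by (rule Max_ge) (use j in auto)
  finally show ?thesis .
qed


section \<open>The computational model\<close>

text \<open>A unit-cost real random access machine, programmed in a while language, with
  natural-number registers, real registers and zero-initialised real arrays. Every
  syntactic operation (including reading a register or a constant) costs one unit.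
  The data of the problem are accessible only through the initial contents of
  the registers and through the oracle queries below. Division by zero yields 0 as
  usual in HOL; a program could test for this itself.\<close>

record state =
  nreg :: "nat \<Rightarrow> nat"
  rreg :: "nat \<Rightarrow> real"
  arr :: "nat \<Rightarrow> nat \<Rightarrow> real"

datatype nexp = NConst nat | NReg nat | NAdd nexp nexp | NSub nexp nexp

datatype rexp = RConst int | RReg nat | RArr nat nexp
  | RAdd rexp rexp | RSub rexp rexp | RMul rexp rexp | RDiv rexp rexp

datatype bexp = NLess nexp nexp | RLess rexp rexp | BNot bexp | BAnd bexp bexp

datatype query = AskDemand rexp | AskIntegral rexp rexp | AskTau rexp | AskTauBar rexp
  | AskSup rexp

datatype com = Skip
  | NAssign nat nexp
  | RAssign nat rexp
  | Store nat nexp rexp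
  | Query nat query
  | Seq com com
  | If bexp com com
  | While bexp com

primrec nval :: "nexp \<Rightarrow> state \<Rightarrow> nat" where
  "nval (NConst k) s = k"
| "nval (NReg x) s = nreg s x"
| "nval (NAdd a b) s = nval a s + nval b s"
| "nval (NSub a b) s = nval a s - nval b s"

primrec rval :: "rexp \<Rightarrow> state \<Rightarrow> real" where
  "rval (RConst k) s = of_int k"
| "rval (RReg x) s = rreg s x"
| "rval (RArr m a) s = arr s m (nval a s)"
| "rval (RAdd a b) s = rval a s + rval b s"
| "rval (RSub a b) s = rval a s - rval b s"
| "rval (RMul a b) s = rval a s * rval b s"
| "rval (RDiv a b) s = rval a s / rval b s"

primrec bval :: "bexp \<Rightarrow> state \<Rightarrow> bool" where
  "bval (NLess a b) s \<longleftrightarrow> nval a s < nval b s"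
| "bval (RLess a b) s \<longleftrightarrow> rval a s < rval b s"
| "bval (BNot b) s \<longleftrightarrow> \<not> bval b s"
| "bval (BAnd b c) s \<longleftrightarrow> bval b s \<and> bval c s"

text \<open>An oracle answers only inside the domain of the queried function; outside of it
  the program is stuck, that is, it has no execution.\<close>

primrec answer :: "shuttle \<Rightarrow> query \<Rightarrow> state \<Rightarrow> real option" where
  "answer P (AskDemand a) s =
     (let t = rval a s in
      if t \<in> {0..period P} then Some (demand P t) else None)"
| "answer P (AskIntegral a b) s =
     (let t = rval a s; u = rval b s in
      if 0 \<le> t \<and> t \<le> u \<and> u \<le> period P then Some (integral {t..u} (demand P)) else None)"
| "answer P (AskTau a) s =
     (let y = rval a s in
      if y \<in> {0..total_demand P} then Some (tau P y) else None)"
| "answer P (AskTauBar a) s =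
     (let y = rval a s in
      if y \<in> {0..total_demand P} then Some (tau_bar P y) else None)"
| "answer P (AskSup a) s =
     (let \<alpha> = rval a s in
      if 0 \<le> \<alpha> then Some (Sup {y \<in> {0..total_demand P}. tau_bar P y + rate P * y \<le> \<alpha>})
      else None)"

primrec ncost :: "nexp \<Rightarrow> nat" where
  "ncost (NConst k) = 1"
| "ncost (NReg x) = 1"
| "ncost (NAdd a b) = 1 + ncost a + ncost b"
| "ncost (NSub a b) = 1 + ncost a + ncost b"

primrec rcost :: "rexp \<Rightarrow> nat" where
  "rcost (RConst k) = 1"
| "rcost (RReg x) = 1"
| "rcost (RArr m a) = 1 + ncost a"
| "rcost (RAdd a b) = 1 + rcost a + rcost b"
| "rcost (RSub a b) = 1 + rcost a + rcost b"
| "rcost (RMul a b) = 1 + rcost a + rcost b"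
| "rcost (RDiv a b) = 1 + rcost a + rcost b"

primrec bcost :: "bexp \<Rightarrow> nat" where
  "bcost (NLess a b) = 1 + ncost a + ncost b"
| "bcost (RLess a b) = 1 + rcost a + rcost b"
| "bcost (BNot b) = 1 + bcost b"
| "bcost (BAnd b c) = 1 + bcost b + bcost c"

primrec qcost :: "query \<Rightarrow> nat" where
  "qcost (AskDemand a) = 1 + rcost a"
| "qcost (AskIntegral a b) = 1 + rcost a + rcost b"
| "qcost (AskTau a) = 1 + rcost a"
| "qcost (AskTauBar a) = 1 + rcost a"
| "qcost (AskSup a) = 1 + rcost a"

text \<open>\<open>exec P c s n s'\<close>: started in state \<open>s\<close>, program \<open>c\<close> halts in state \<open>s'\<close> after
  \<open>n\<close> units of time.\<close>

inductive exec :: "shuttle \<Rightarrow> com \<Rightarrow> state \<Rightarrow> nat \<Rightarrow> state \<Rightarrow> bool" for P :: shuttle where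
  exec_Skip: "exec P Skip s 1 s"
| exec_NAssign: "exec P (NAssign x a) s (1 + ncost a) (s\<lparr>nreg := (nreg s)(x := nval a s)\<rparr>)"
| exec_RAssign: "exec P (RAssign x a) s (1 + rcost a) (s\<lparr>rreg := (rreg s)(x := rval a s)\<rparr>)"
| exec_Store: "exec P (Store m a b) s (1 + ncost a + rcost b)
    (s\<lparr>arr := (arr s)(m := (arr s m)(nval a s := rval b s))\<rparr>)"
| exec_Query: "answer P q s = Some v \<Longrightarrow>
    exec P (Query x q) s (1 + qcost q) (s\<lparr>rreg := (rreg s)(x := v)\<rparr>)"
| exec_Seq: "exec P c s n s' \<Longrightarrow> exec P c' s' n' s'' \<Longrightarrow> exec P (Seq c c') s (n + n') s''"
| exec_IfTrue: "bval b s \<Longrightarrow> exec P c s n s' \<Longrightarrow> exec P (If b c c') s (1 + bcost b + n) s'"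
| exec_IfFalse: "\<not> bval b s \<Longrightarrow> exec P c' s n s' \<Longrightarrow> exec P (If b c c') s (1 + bcost b + n) s'"
| exec_WhileFalse: "\<not> bval b s \<Longrightarrow> exec P (While b c) s (1 + bcost b) s"
| exec_WhileTrue: "bval b s \<Longrightarrow> exec P c s n s' \<Longrightarrow> exec P (While b c) s' n' s'' \<Longrightarrow>
    exec P (While b c) s (1 + bcost b + n + n') s''"

inductive_cases SkipE: "exec P Skip s n t"
  and NAssignE: "exec P (NAssign x a) s n t"
  and RAssignE: "exec P (RAssign x a) s n t"
  and StoreE: "exec P (Store m a b) s n t"
  and QueryE: "exec P (Query x q) s n t"
  and SeqE: "exec P (Seq c c') s n t"
  and IfE: "exec P (If b c c') s n t"
  and WhileE: "exec P (While b c) s n t"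

text \<open>The machine is deterministic: running time and result are functions of the input.\<close>

lemma exec_deterministic:
  "exec P c s n t \<Longrightarrow> exec P c s n' t' \<Longrightarrow> n' = n \<and> t' = t"
proof (induction arbitrary: n' t' rule: exec.induct)
  case exec_Skip
  then show ?case by - (erule SkipE, simp)
next
  case exec_NAssign
  then show ?case by - (erule NAssignE, simp)
next
  case exec_RAssign
  then show ?case by - (erule RAssignE, simp)
next
  case exec_Store
  then show ?case by - (erule StoreE, simp)
next
  case exec_Query
  then show ?case by - (erule QueryE, simp)
next
  case (exec_Seq c s m u c' m' v)
  from exec_Seq.prems obtain i w j
    where *: "n' = i + j" "exec P c s i w" "exec P c' w j t'"
    by (rule SeqE)
  from exec_Seq.IH(1)[OF *(2)] exec_Seq.IH(2)[of j t'] * show ?case by simp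
next
  case (exec_IfTrue b s c m u c')
  from exec_IfTrue.prems exec_IfTrue.hyps(1) obtain i
    where *: "n' = Suc (bcost b + i)" "exec P c s i t'"
    by - (erule IfE, simp_all)
  from exec_IfTrue.IH[OF *(2)] * show ?case by simp
next
  case (exec_IfFalse b s c' m u c)
  from exec_IfFalse.prems exec_IfFalse.hyps(1) obtain i
    where *: "n' = Suc (bcost b + i)" "exec P c' s i t'"
    by - (erule IfE, simp_all)
  from exec_IfFalse.IH[OF *(2)] * show ?case by simp
next
  case (exec_WhileFalse b s c)
  from exec_WhileFalse.prems exec_WhileFalse.hyps show ?case
    by - (erule WhileE, simp_all)
next
  case (exec_WhileTrue b s c m u m' v)
  from exec_WhileTrue.prems exec_WhileTrue.hyps(1) obtain i w j
    where *: "n' = Suc (bcost b + i + j)" "exec P c s i w" "exec P (While b c) w j t'"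
    by - (erule WhileE, simp_all)
  from exec_WhileTrue.IH(1)[OF *(2)] exec_WhileTrue.IH(2)[of j t'] * show ?case by simp
qed

text \<open>Input: the number of shuttles, the constants of the instance and the accuracy.
  Output: the vectors \<open>d\<close> and \<open>y\<close> are found in the arrays 0 and 1.\<close>

definition input :: "shuttle \<Rightarrow> nat \<Rightarrow> real \<Rightarrow> state" where
  "input P S \<rho> =
     \<lparr>nreg = (\<lambda>_. 0)(0 := S),
      rreg = (\<lambda>_. 0)(0 := capacity P, 1 := period P, 2 := rate P, 3 := \<rho>),
      arr = (\<lambda>_ _. 0)\<rparr>"

abbreviation output_d :: "state \<Rightarrow> nat \<Rightarrow> real" where
  "output_d s \<equiv> arr s 0"

abbreviation output_y :: "state \<Rightarrow> nat \<Rightarrow> real" where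
  "output_y s \<equiv> arr s 1"

text \<open>The bound \<open>O (S log (1 / \<rho>))\<close>. Since the logarithm is close to 0 or negative for
  larger \<open>\<rho>\<close>, it is replaced by 1 for \<open>\<rho> > 1/2\<close>.\<close>

definition time_bound :: "nat \<Rightarrow> real \<Rightarrow> real" where
  "time_bound S \<rho> = real S * max 1 (log 2 (1 / \<rho>))"

end

theory Submission
  imports Defs
begin

text \<open>For a fixed target value \<open>\<lambda>\<close>, whether some solution has objective at most \<open>\<lambda>\<close> is
  decided greedily: each shuttle takes as many users as the capacity and the departure
  time permit, where it must depart no later than \<open>\<lambda>\<close> after the first of its users arrives.
  Taking more users can only help the later shuttles, since \<open>tau\<close> is monotone. Hence the
  greedy loads dominate those of every solution with objective at most \<open>\<lambda>\<close>
  (\<open>greedy_dominates\<close>), so that the greedy solution serves the whole demand if there is such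
  a solution (\<open>le_OPT_if_greedy_fails\<close>). Conversely, if it serves the whole demand, then the
  departure times \<open>\<lambda> + tau (y (j - 1))\<close> make it a feasible solution of objective exactly
  \<open>\<lambda>\<close> (\<open>greedy_solution\<close>).

  The greedy step is a single query for the supremum, because \<open>tau_bar\<close> is
  left-continuous, so that the supremum is attained
  (\<open>reach_attained\<close>).

  Bisection on \<open>\<lambda>\<close> starts from the interval between 0 and \<open>period + rate * capacity\<close>; the
  upper end always succeeds, as every departure then may wait until the end of the period and
  still load a full shuttle (\<open>greedy_large_target\<close>). The lower end is always at most the
  optimum and the upper end is always the value of a greedy solution, so an interval of length
  at most \<open>\<rho>\<close> yields the accuracy. The initial length is a constant of the instance, hence
  \<open>O(log (1 / \<rho>))\<close> greedy passes suffice, each of which takes time \<open>O(S)\<close>.\<close>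

section \<open>Pseudo-inverses of the demand\<close>

lemma shuttle_dataD:
  assumes "shuttle_data P"
  shows "0 \<le> capacity P" "0 \<le> period P" "0 \<le> rate P" "0 < total_demand P"
    and "\<lbrakk>0 \<le> t; t \<le> period P\<rbrakk> \<Longrightarrow> 0 \<le> demand P t"
    and "\<lbrakk>0 \<le> t; t \<le> u; u \<le> period P\<rbrakk> \<Longrightarrow> demand P t \<le> demand P u"
  using assms by (auto simp: shuttle_data_def mono_on_def)

context
  fixes P :: shuttle
  assumes P: "shuttle_data P"
begin

lemma tau_bar_le: "\<lbrakk>0 \<le> t; t \<le> period P; y \<le> demand P t\<rbrakk> \<Longrightarrow> tau_bar P y \<le> t"
  unfolding tau_bar_def by (rule cInf_lower) (auto intro: bdd_belowI[of _ 0])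

lemma tau_bar_nonneg:
  assumes "y \<le> total_demand P"
  shows "0 \<le> tau_bar P y"
  unfolding tau_bar_def
proof (rule cInf_greatest)
  show "{t \<in> {0..period P}. y \<le> demand P t} \<noteq> {}"
    using assms shuttle_dataD(2)[OF P] by auto
qed simp

lemma tau_bar_le_period: "y \<le> total_demand P \<Longrightarrow> tau_bar P y \<le> period P"
  using tau_bar_le shuttle_dataD(2)[OF P] by blast

lemma tau_bar_0: "tau_bar P 0 = 0"
  using tau_bar_le[of 0 0] tau_bar_nonneg[of 0] shuttle_dataD[OF P] by force

lemma tau_bar_mono:
  assumes "y \<le> z" "z \<le> total_demand P"
  shows "tau_bar P y \<le> tau_bar P z"
  unfolding tau_bar_def
proof (rule cInf_superset_mono)
  show "{t \<in> {0..period P}. z \<le> demand P t} \<noteq> {}"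
    using assms shuttle_dataD(2)[OF P] by auto
  show "bdd_below {t \<in> {0..period P}. y \<le> demand P t}"
    by (rule bdd_belowI[of _ 0]) simp
qed (use assms in auto)

text \<open>The infimum in \<open>tau_bar\<close> is attained: a monotone upper semicontinuous function is
  continuous from the right, so that \<open>demand P t < y\<close> persists slightly beyond \<open>t\<close>.\<close>

lemma tau_bar_le_iff:
  assumes t: "0 \<le> t" "t \<le> period P" and y: "y \<le> total_demand P"
  shows "tau_bar P y \<le> t \<longleftrightarrow> y \<le> demand P t"
proof
  assume le: "tau_bar P y \<le> t"
  show "y \<le> demand P t"
  proof (rule ccontr)
    assume "\<not> y \<le> demand P t"
    then have "\<forall>\<^sub>F x in at t within {0..period P}. demand P x < y"
      using P t by (auto simp: shuttle_data_def usc_on_def)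
    then obtain e where e: "e > 0"
      and below: "\<And>x. \<lbrakk>0 \<le> x; x \<le> period P; x \<noteq> t; dist x t < e\<rbrakk> \<Longrightarrow> demand P x < y"
      unfolding eventually_at by auto
    have "t + e \<le> tau_bar P y"
      unfolding tau_bar_def
    proof (rule cInf_greatest)
      show "{t \<in> {0..period P}. y \<le> demand P t} \<noteq> {}"
        using y shuttle_dataD(2)[OF P] by auto
    next
      fix u assume u: "u \<in> {t \<in> {0..period P}. y \<le> demand P t}"
      then have "t < u"
        using shuttle_dataD(6)[OF P, of u t] t \<open>\<not> y \<le> demand P t\<close> by force
      then show "t + e \<le> u"
        using below[of u] u by (force simp: dist_real_def)
    qed
    with le e show False by simp
  qed
qed (use tau_bar_le t in blast)

lemma tau_nonneg:
  assumes "y \<le> total_demand P"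
  shows "0 \<le> tau P y"
proof (cases "y < total_demand P")
  case True
  then have "{t \<in> {0..period P}. y < demand P t} \<noteq> {}"
    using shuttle_dataD(2)[OF P] by auto
  then show ?thesis
    using True unfolding tau_def by (auto intro!: cInf_greatest)
qed (use shuttle_dataD(2)[OF P] in \<open>simp add: tau_def\<close>)

lemma tau_mono:
  assumes "y \<le> z" "z \<le> total_demand P"
  shows "tau P y \<le> tau P z"
proof (cases "z < total_demand P")
  case True
  have "Inf {t \<in> {0..period P}. y < demand P t} \<le> Inf {t \<in> {0..period P}. z < demand P t}"
  proof (rule cInf_superset_mono)
    show "{t \<in> {0..period P}. z < demand P t} \<noteq> {}"
      using True shuttle_dataD(2)[OF P] by auto
    show "bdd_below {t \<in> {0..period P}. y < demand P t}"
      by (rule bdd_belowI[of _ 0]) simp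
  qed (use assms in auto)
  then show ?thesis using True assms by (simp add: tau_def)
next
  case False
  have "Inf {t \<in> {0..period P}. y < demand P t} \<le> period P" if "y < total_demand P"
    by (rule cInf_lower) (use that shuttle_dataD(2)[OF P] in \<open>auto intro: bdd_belowI[of _ 0]\<close>)
  then show ?thesis using False by (simp add: tau_def)
qed

lemma tau_bar_le_tau:
  assumes "y \<le> total_demand P"
  shows "tau_bar P y \<le> tau P y"
proof (cases "y < total_demand P")
  case True
  have "Inf {t \<in> {0..period P}. y \<le> demand P t} \<le> Inf {t \<in> {0..period P}. y < demand P t}"
  proof (rule cInf_superset_mono)
    show "{t \<in> {0..period P}. y < demand P t} \<noteq> {}"
      using True shuttle_dataD(2)[OF P] by auto
    show "bdd_below {t \<in> {0..period P}. y \<le> demand P t}"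
      by (rule bdd_belowI[of _ 0]) simp
  qed auto
  then show ?thesis using True by (simp add: tau_def tau_bar_def)
qed (use assms tau_bar_le_period in \<open>simp add: tau_def\<close>)


end


section \<open>The greedy solution for a target value\<close>

definition reach :: "shuttle \<Rightarrow> real \<Rightarrow> real" where
  "reach P \<alpha> = Sup {y \<in> {0..total_demand P}. tau_bar P y + rate P * y \<le> \<alpha>}"

text \<open>A shuttle that departs at \<open>l + tau (y (j - 1))\<close> must satisfy
  \<open>tau_bar (y j) + rate * (y j - y (j - 1)) \<le> l + tau (y (j - 1))\<close>. With the known summand
  \<open>rate * y (j - 1)\<close> moved to the right, this is the condition of which \<open>reach\<close> gives the largest
  solution \<open>y j\<close>.\<close>

primrec greedy :: "shuttle \<Rightarrow> real \<Rightarrow> nat \<Rightarrow> real" where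
  "greedy P l 0 = 0"
| "greedy P l (Suc j) = min (reach P (l + tau P (greedy P l j) + rate P * greedy P l j))
     (greedy P l j + capacity P)"

lemma feasible_Suc:
  assumes "feasible P S d y" "j < S"
  shows "0 \<le> y (Suc j)" "y j \<le> y (Suc j)" "y (Suc j) - y j \<le> capacity P"
    "tau_bar P (y (Suc j)) + rate P * (y (Suc j) - y j) \<le> d (Suc j)"
proof -
  have "Suc j \<in> {1..S}" using assms(2) by simp
  then show "0 \<le> y (Suc j)" "y j \<le> y (Suc j)" "y (Suc j) - y j \<le> capacity P"
    "tau_bar P (y (Suc j)) + rate P * (y (Suc j) - y j) \<le> d (Suc j)"
    using assms(1) unfolding feasible_def by (metis diff_Suc_1)+
qed

lemma feasible_le_total:
  assumes F: "feasible P S d y" and j: "j \<le> S"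
  shows "y j \<le> total_demand P"
proof -
  have "y j \<le> y S"
    using j by (induction rule: inc_induct) (use feasible_Suc(2)[OF F] in \<open>force+\<close>)
  then show ?thesis using F by (simp add: feasible_def)
qed

context
  fixes P :: shuttle
  assumes P: "shuttle_data P"
begin

lemma le_reach: "\<lbrakk>0 \<le> y; y \<le> total_demand P; tau_bar P y + rate P * y \<le> \<alpha>\<rbrakk> \<Longrightarrow> y \<le> reach P \<alpha>"
  unfolding reach_def by (rule cSup_upper) (auto intro: bdd_aboveI[of _ "total_demand P"])

text \<open>All \<open>z\<close> below the supremum satisfy \<open>tau_bar P z \<le> \<alpha> - rate P * z\<close>, and \<open>tau_bar\<close> is
  continuous from the left, since \<open>tau_bar P z \<le> t\<close> means \<open>z \<le> demand P t\<close>, which is a closed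
  condition on \<open>z\<close>.\<close>

lemma reach_attained:
  assumes \<alpha>: "0 \<le> \<alpha>"
  shows "0 \<le> reach P \<alpha>" "reach P \<alpha> \<le> total_demand P"
    and "tau_bar P (reach P \<alpha>) + rate P * reach P \<alpha> \<le> \<alpha>"
proof -
  let ?A = "{y \<in> {0..total_demand P}. tau_bar P y + rate P * y \<le> \<alpha>}"
  let ?m = "reach P \<alpha>"
  have zero: "0 \<in> ?A" using \<alpha> tau_bar_0[OF P] shuttle_dataD(4)[OF P] by simp
  show m0: "0 \<le> ?m" using le_reach[of 0 \<alpha>] zero by simp
  show mD: "?m \<le> total_demand P"
    unfolding reach_def by (rule cSup_least) (use zero in auto)
  show "tau_bar P ?m + rate P * ?m \<le> \<alpha>"
  proof (cases "?m = 0")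
    case True
    then show ?thesis using zero by simp
  next
    case False
    with m0 have mpos: "0 < ?m" by simp
    have below: "tau_bar P y + rate P * y \<le> \<alpha>" if "y < ?m" for y
    proof -
      have "?A \<noteq> {}" using zero by blast
      then have "\<exists>z\<in>?A. y < z"
        by (rule less_cSupD) (use that in \<open>simp add: reach_def\<close>)
      then obtain z where z: "z \<in> ?A" "y < z" by blast
      then have "tau_bar P y \<le> tau_bar P z" "rate P * y \<le> rate P * z"
        using tau_bar_mono[OF P, of y z] shuttle_dataD(3)[OF P] by (auto intro: mult_left_mono)
      then show ?thesis using z by simp
    qed
    (* beyond the period the bound on tau_bar is trivial; there tau_bar_le_iff does not apply *)
    have limit: "tau_bar P ?m \<le> \<alpha> - rate P * y" if y: "0 \<le> y" "y < ?m" for y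
    proof (cases "\<alpha> - rate P * y \<le> period P")
      case True
      let ?t = "\<alpha> - rate P * y"
      have t0: "0 \<le> ?t"
        using below[OF y(2)] tau_bar_nonneg[OF P, of y] y mD by simp
      have "?m \<le> demand P ?t"
      proof (rule dense_le_bounded[OF y(2)])
        fix z assume z: "y < z" "z < ?m"
        have "rate P * y \<le> rate P * z"
          using z shuttle_dataD(3)[OF P] by (intro mult_left_mono) auto
        then have "tau_bar P z \<le> ?t" using below[OF z(2)] by simp
        then show "z \<le> demand P ?t"
          using tau_bar_le_iff[OF P t0 True, of z] z mD by simp
      qed
      then show ?thesis using tau_bar_le[OF P t0 True] by simp
    next
      case False
      then show ?thesis using tau_bar_le_period[OF P mD] by simp
    qed
    have "rate P * ?m \<le> \<alpha> - tau_bar P ?m"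
    proof (rule field_le_mult_one_interval)
      fix x :: real assume "0 < x" "x < 1"
      then show "x * (rate P * ?m) \<le> \<alpha> - tau_bar P ?m"
        using limit[of "x * ?m"] mpos by (simp add: mult.left_commute)
    qed
    then show ?thesis by simp
  qed
qed

context
  fixes l :: real
  assumes l: "0 \<le> l"
begin

lemma greedy_budget_nonneg:
  assumes "0 \<le> y" "y \<le> total_demand P"
  shows "0 \<le> l + tau P y + rate P * y"
  using tau_nonneg[OF P assms(2)] l assms shuttle_dataD(3)[OF P] by simp

lemma greedy_bounds: "0 \<le> greedy P l j \<and> greedy P l j \<le> total_demand P"
proof (induction j)
  case 0
  then show ?case using shuttle_dataD(4)[OF P] by simp
next
  case (Suc j)
  then show ?case
    using reach_attained(1,2)[OF greedy_budget_nonneg[of "greedy P l j"]] shuttle_dataD(1)[OF P]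
    by auto
qed

lemma greedy_mono_Suc: "greedy P l j \<le> greedy P l (Suc j)"
  using le_reach[of "greedy P l j" "l + tau P (greedy P l j) + rate P * greedy P l j"]
    greedy_bounds[of j] tau_bar_le_tau[OF P, of "greedy P l j"] l shuttle_dataD(1)[OF P]
  by simp

text \<open>The supremum itself meets the departure bound, and so does every smaller load; hence
  capping at the capacity is harmless.\<close>

lemma greedy_departure:
  "tau_bar P (greedy P l (Suc j)) + rate P * (greedy P l (Suc j) - greedy P l j)
     \<le> l + tau P (greedy P l j)"
proof -
  let ?y = "greedy P l j" and ?z = "greedy P l (Suc j)"
  let ?r = "reach P (l + tau P ?y + rate P * ?y)"
  have r: "?r \<le> total_demand P" "tau_bar P ?r + rate P * ?r \<le> l + tau P ?y + rate P * ?y"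
    using reach_attained(2,3)[OF greedy_budget_nonneg[of ?y]] greedy_bounds[of j] by auto
  have "?z \<le> ?r" by simp
  then have "tau_bar P ?z \<le> tau_bar P ?r" "rate P * ?z \<le> rate P * ?r"
    using tau_bar_mono[OF P _ r(1)] shuttle_dataD(3)[OF P] by (auto intro: mult_left_mono)
  then show ?thesis using r(2) by (simp add: right_diff_distrib del: greedy.simps)
qed

text \<open>Departing as late as the target permits makes every waiting time equal to \<open>l\<close>, and the
  departures are ordered because the arrival times \<open>tau\<close> are.\<close>

lemma greedy_solution:
  assumes all: "greedy P l S = total_demand P"
    and y: "\<forall>i\<le>S. y i = greedy P l i"
    and d: "\<forall>i<S. d (Suc i) = l + tau P (greedy P l i)"
  shows "feasible P S d y" "gmax P S d y = l"
proof -
  have y': "y j = greedy P l j" "y (j - 1) = greedy P l (j - 1)" if "j \<in> {1..S}" for j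
    using y that by auto
  have d': "d j = l + tau P (greedy P l (j - 1))" if "j \<in> {1..S}" for j
    using d[rule_format, of "j - 1"] that by auto
  have bounds: "0 \<le> greedy P l i" "greedy P l i \<le> total_demand P" for i
    using greedy_bounds[of i] by auto
  have step: "greedy P l (j - 1) \<le> greedy P l j"
    "greedy P l j - greedy P l (j - 1) \<le> capacity P"
    "tau_bar P (greedy P l j) + rate P * (greedy P l j - greedy P l (j - 1)) \<le> d j"
    if "j \<in> {1..S}" for j
  proof -
    from that obtain i where "j = Suc i" by (cases j) auto
    then show "greedy P l (j - 1) \<le> greedy P l j"
      "greedy P l j - greedy P l (j - 1) \<le> capacity P"
      "tau_bar P (greedy P l j) + rate P * (greedy P l j - greedy P l (j - 1)) \<le> d j"
      using greedy_mono_Suc[of i] greedy_departure[of i] d'[OF that] by auto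
  qed
  have dmono: "d (j - 1) \<le> d j" if "j \<in> {2..S}" for j
  proof -
    have "j - 1 \<in> {1..S}" "j \<in> {1..S}" using that by auto
    then show ?thesis
      using d' step(1)[of "j - 1"] tau_mono[OF P _ bounds(2)] by simp
  qed
  show F: "feasible P S d y"
    unfolding feasible_def
    using y all bounds y' d' dmono step tau_nonneg[OF P bounds(2)] l by auto
  have "{j \<in> {1..S}. y (j - 1) < y j} \<noteq> {}"
  proof
    assume "{j \<in> {1..S}. y (j - 1) < y j} = {}"
    then have le: "y j \<le> y (j - 1)" if "j \<in> {1..S}" for j using that by force
    have "j \<le> S \<Longrightarrow> y j \<le> 0" for j
    proof (induction j)
      case 0
      then show ?case using y by simp
    next
      case (Suc j)
      then show ?case using le[of "Suc j"] by simp
    qed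
    from this[of S] show False using y all shuttle_dataD(4)[OF P] by simp
  qed
  then have "(\<lambda>j. d j - tau P (y (j - 1))) ` {j \<in> {1..S}. y (j - 1) < y j} = {l}"
    using y' d' by (auto simp: image_iff)
  then show "gmax P S d y = l" by (simp add: gmax_def)
qed

text \<open>Induction along the shuttles. Starting from a larger cumulated load, a shuttle has a later
  deadline \<open>l + tau P (y j)\<close> and less left to load, hence it also reaches at least as far. A shuttle
  that takes nobody is not bound by the target, but then its load is already dominated.\<close>

lemma greedy_dominates:
  assumes F: "feasible P S d y" and g: "gmax P S d y \<le> l"
  shows "j \<le> S \<Longrightarrow> y j \<le> greedy P l j"
proof (induction j)
  case 0
  then show ?case using F by (simp add: feasible_def)
next
  case (Suc j)
  let ?x = "greedy P l j"
  have IH: "y j \<le> ?x" and j: "Suc j \<in> {1..S}" using Suc by auto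
  show ?case
  proof (cases "y j < y (Suc j)")
    case True
    have D: "y (Suc j) \<le> total_demand P" by (rule feasible_le_total[OF F Suc.prems])
    have "d (Suc j) - tau P (y j) \<le> gmax P S d y"
      unfolding gmax_def
      by (rule Max_ge, simp) (use j True in \<open>auto simp: image_iff intro!: bexI[of _ "Suc j"]\<close>)
    then have "d (Suc j) \<le> l + tau P (y j)" using g by simp
    moreover note feasible_Suc[OF F, of j]
    moreover have "tau P (y j) \<le> tau P ?x" "rate P * y j \<le> rate P * ?x"
      using tau_mono[OF P IH] greedy_bounds[of j] shuttle_dataD(3)[OF P] IH
      by (auto intro: mult_left_mono)
    ultimately show ?thesis
      using le_reach[OF _ D] IH Suc.prems by (auto simp: right_diff_distrib)
  next
    case False
    then show ?thesis using IH greedy_mono_Suc[of j] by simp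
  qed
qed

lemma le_OPT_if_greedy_fails:
  assumes F: "\<exists>d y. feasible P S d y" and fails: "greedy P l S < total_demand P"
  shows "l \<le> OPT P S"
  unfolding OPT_def
proof (rule cInf_greatest)
  fix g assume "g \<in> {gmax P S d y | d y. feasible P S d y}"
  then obtain d y where g: "g = gmax P S d y" and dy: "feasible P S d y" by blast
  show "l \<le> g"
  proof (rule ccontr)
    assume "\<not> l \<le> g"
    then have "y S \<le> greedy P l S" using greedy_dominates[OF dy, of S] g by simp
    then show False using fails dy by (simp add: feasible_def)
  qed
qed (use F in auto)

end

lemma OPT_nonneg: "\<exists>d y. feasible P S d y \<Longrightarrow> 0 \<le> OPT P S"
  unfolding OPT_def using gmax_nonneg[OF P] by (auto intro!: cInf_greatest)

lemma feasible_total_le: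
  assumes F: "feasible P S d y"
  shows "total_demand P \<le> real S * capacity P"
proof -
  have "j \<le> S \<Longrightarrow> y j \<le> real j * capacity P" for j
  proof (induction j)
    case 0
    then show ?case using F by (simp add: feasible_def)
  next
    case (Suc j)
    then show ?case using feasible_Suc(3)[OF F, of j] by (simp add: algebra_simps)
  qed
  from this[of S] show ?thesis using F by (simp add: feasible_def)
qed

text \<open>With this target the capacity is the only obstacle to taking all users at once.\<close>

lemma greedy_large_target:
  assumes F: "feasible P S d y"
  shows "greedy P (period P + rate P * capacity P) S = total_demand P"
proof -
  let ?l = "period P + rate P * capacity P"
  have l: "0 \<le> ?l" using shuttle_dataD(1-3)[OF P] by simp
  have "min (real j * capacity P) (total_demand P) \<le> greedy P ?l j" for j
  proof (induction j)
    case 0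
    then show ?case by simp
  next
    case (Suc j)
    let ?y = "greedy P ?l j"
    let ?z = "min (?y + capacity P) (total_demand P)"
    have y: "0 \<le> ?y" "?y \<le> total_demand P" using greedy_bounds[OF l, of j] by auto
    have z: "0 \<le> ?z" "?z \<le> total_demand P" using y shuttle_dataD(1)[OF P] by auto
    have "rate P * ?z \<le> rate P * (?y + capacity P)"
      using shuttle_dataD(3)[OF P] by (intro mult_left_mono) auto
    then have "tau_bar P ?z + rate P * ?z \<le> ?l + tau P ?y + rate P * ?y"
      using tau_bar_le_period[OF P z(2)] tau_nonneg[OF P y(2)] by (simp add: algebra_simps)
    then have "?z \<le> reach P (?l + tau P ?y + rate P * ?y)" by (rule le_reach[OF z])
    then have "?z \<le> greedy P ?l (Suc j)" by simp
    moreover have "min (real (Suc j) * capacity P) (total_demand P) \<le> ?z"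
      using Suc shuttle_dataD(1)[OF P] by (auto simp: algebra_simps)
    ultimately show ?case by simp
  qed
  from this[of S] show ?thesis
    using feasible_total_le[OF F] greedy_bounds[OF l, of S] by simp
qed

end


section \<open>Running programs\<close>

text \<open>The weakest precondition of a program, where the postcondition may also depend on the
  running time. In this form the rules for loop-free programs are equations, so that the
  simplifier executes such programs symbolically.\<close>

definition runs :: "shuttle \<Rightarrow> com \<Rightarrow> state \<Rightarrow> (nat \<Rightarrow> state \<Rightarrow> bool) \<Rightarrow> bool" where
  "runs P c s Q \<longleftrightarrow> (\<exists>n t. exec P c s n t \<and> Q n t)"

lemma runs_determ: "exec P c s n t \<Longrightarrow> runs P c s Q = Q n t"
  unfolding runs_def using exec_deterministic by blast

lemma runs_simps:
  "runs P (NAssign x a) s Q = Q (1 + ncost a) (s\<lparr>nreg := (nreg s)(x := nval a s)\<rparr>)"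
  "runs P (RAssign x e) s Q = Q (1 + rcost e) (s\<lparr>rreg := (rreg s)(x := rval e s)\<rparr>)"
  "runs P (Store m a e) s Q = Q (1 + ncost a + rcost e)
     (s\<lparr>arr := (arr s)(m := (arr s m)(nval a s := rval e s))\<rparr>)"
  by (rule runs_determ, rule exec.intros)+

lemma runs_Query:
  "runs P (Query x q) s Q \<longleftrightarrow>
     (\<exists>v. answer P q s = Some v \<and> Q (1 + qcost q) (s\<lparr>rreg := (rreg s)(x := v)\<rparr>))"
  unfolding runs_def
proof safe
  fix n t assume "exec P (Query x q) s n t" "Q n t"
  then show "\<exists>v. answer P q s = Some v \<and> Q (1 + qcost q) (s\<lparr>rreg := (rreg s)(x := v)\<rparr>)"
    by (auto elim!: QueryE)
qed (use exec_Query in blast)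

lemma runs_Seq: "runs P (Seq c c') s Q = runs P c s (\<lambda>m t. runs P c' t (\<lambda>n. Q (m + n)))"
  unfolding runs_def by (blast elim!: SeqE intro: exec_Seq)

lemma runs_If:
  "runs P (If b c c') s Q = (if bval b s then runs P c s (\<lambda>n. Q (1 + bcost b + n))
     else runs P c' s (\<lambda>n. Q (1 + bcost b + n)))"
proof -
  have "exec P (If b c c') s n t \<longleftrightarrow>
      (\<exists>m. n = 1 + bcost b + m \<and> exec P (if bval b s then c else c') s m t)" for n t
    by (auto elim!: IfE intro: exec_IfTrue[simplified] exec_IfFalse[simplified])
  then show ?thesis unfolding runs_def by auto
qed

lemmas runs_wp = runs_simps runs_Query runs_Seq runs_If

lemma runs_mono:
  "runs P c s Q \<Longrightarrow> (\<And>n t. Q n t \<Longrightarrow> R n t) \<Longrightarrow> runs P c s R"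
  unfolding runs_def by blast

text \<open>The parameter \<open>k\<close> of the invariant bounds the number of iterations that remain; the
  loop may stop earlier.\<close>

lemma runs_While:
  assumes step: "\<And>k s. \<lbrakk>I k s; bval b s\<rbrakk> \<Longrightarrow>
      \<exists>k'. k = Suc k' \<and> runs P c s (\<lambda>n t. n \<le> B \<and> I k' t)"
    and init: "I k s"
  shows "runs P (While b c) s
    (\<lambda>n t. n \<le> (k + 1) * (1 + bcost b + B) \<and> (\<exists>k'. I k' t) \<and> \<not> bval b t)"
  using init
proof (induction k arbitrary: s)
  case 0
  then have "\<not> bval b s" using step by blast
  then show ?case using 0 exec_WhileFalse[of b s P c] by (fastforce simp: runs_def)
next
  case (Suc k)
  show ?case
  proof (cases "bval b s")
    case True
    obtain m u where 1: "exec P c s m u" "m \<le> B" "I k u"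
      using step[OF Suc.prems True] by (auto simp: runs_def)
    obtain n t where 2: "exec P (While b c) u n t" "n \<le> (k + 1) * (1 + bcost b + B)"
      "\<exists>k'. I k' t" "\<not> bval b t"
      using Suc.IH[OF 1(3)] by (auto simp: runs_def)
    have "exec P (While b c) s (1 + bcost b + m + n) t"
      by (rule exec_WhileTrue[OF True 1(1) 2(1)])
    moreover have "1 + bcost b + m + n \<le> (Suc k + 1) * (1 + bcost b + B)"
      using 1(2) 2(2) by simp
    ultimately show ?thesis using 2 unfolding runs_def by blast
  next
    case False
    then show ?thesis using Suc.prems exec_WhileFalse[of b s P c] by (fastforce simp: runs_def)
  qed
qed


section \<open>The bisection program\<close>

text \<open>Register use: natural register 1 counts the shuttles; real registers 4 and 5 hold the
  ends of the search interval, 6 the total demand and 7 the target value of the greedy pass.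
  Registers 8 and 9 hold the two answers needed for one shuttle.\<close>

definition greedy_step :: com where
  "greedy_step =
     Seq (Query 8 (AskTau (RArr 1 (NReg 1))))
    (Seq (Query 9 (AskSup (RAdd (RAdd (RReg 7) (RReg 8)) (RMul (RReg 2) (RArr 1 (NReg 1))))))
    (Seq (Store 0 (NAdd (NReg 1) (NConst 1)) (RAdd (RReg 7) (RReg 8)))
    (Seq (If (RLess (RReg 9) (RAdd (RArr 1 (NReg 1)) (RReg 0)))
           (Store 1 (NAdd (NReg 1) (NConst 1)) (RReg 9))
           (Store 1 (NAdd (NReg 1) (NConst 1)) (RAdd (RArr 1 (NReg 1)) (RReg 0))))
         (NAssign 1 (NAdd (NReg 1) (NConst 1))))))"

definition greedy_pass :: com where
  "greedy_pass = Seq (NAssign 1 (NConst 0)) (While (NLess (NReg 1) (NReg 0)) greedy_step)"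

definition bisection_step :: com where
  "bisection_step =
     Seq (RAssign 7 (RDiv (RAdd (RReg 4) (RReg 5)) (RConst 2)))
    (Seq greedy_pass
      (If (RLess (RArr 1 (NReg 0)) (RReg 6)) (RAssign 4 (RReg 7)) (RAssign 5 (RReg 7))))"

definition bisection :: com where
  "bisection =
     Seq (Query 6 (AskDemand (RReg 1)))
    (Seq (RAssign 5 (RAdd (RReg 1) (RMul (RReg 2) (RReg 0))))
    (Seq (While (RLess (RReg 3) (RSub (RReg 5) (RReg 4))) bisection_step)
    (Seq (RAssign 7 (RReg 5)) greedy_pass)))"

text \<open>The entry \<open>0\<close> of the array of loads is the convention \<open>y 0 = 0\<close>; no pass writes it.\<close>

definition holds_data :: "shuttle \<Rightarrow> nat \<Rightarrow> state \<Rightarrow> bool" where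
  "holds_data P S s \<longleftrightarrow> nreg s 0 = S \<and> rreg s 0 = capacity P \<and> rreg s 1 = period P \<and>
     rreg s 2 = rate P \<and> output_y s 0 = 0"

definition holds_greedy :: "shuttle \<Rightarrow> real \<Rightarrow> nat \<Rightarrow> state \<Rightarrow> bool" where
  "holds_greedy P l j s \<longleftrightarrow> (\<forall>i\<le>j. output_y s i = greedy P l i) \<and>
     (\<forall>i<j. output_d s (Suc i) = l + tau P (greedy P l i))"

text \<open>Invariant of the bisection when at most \<open>k\<close> iterations remain: the loop condition says
  that the length of the search interval exceeds \<open>\<rho>\<close>, so it forces \<open>k\<close> to be positive, and
  halving the interval then decreases \<open>k\<close>.\<close>

definition bracket :: "shuttle \<Rightarrow> nat \<Rightarrow> real \<Rightarrow> nat \<Rightarrow> state \<Rightarrow> bool" where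
  "bracket P S \<rho> k s \<longleftrightarrow> holds_data P S s \<and> rreg s 3 = \<rho> \<and> rreg s 6 = total_demand P \<and>
     0 \<le> rreg s 4 \<and> rreg s 4 \<le> OPT P S \<and>
     0 \<le> rreg s 5 \<and> greedy P (rreg s 5) S = total_demand P \<and>
     rreg s 5 - rreg s 4 \<le> \<rho> * 2 ^ k"

lemma answer_AskSup:
  "answer P (AskSup a) s = (if 0 \<le> rval a s then Some (reach P (rval a s)) else None)"
  by (simp add: Let_def reach_def)

context
  fixes P :: shuttle
  assumes P: "shuttle_data P"
begin

text \<open>The constants 45 here and 49 below bound the time for one shuttle, without and with the
  loop test.\<close>

lemma runs_greedy_step:
  assumes "holds_data P S s" "0 \<le> rreg s 7" "holds_greedy P (rreg s 7) (nreg s 1) s"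
  shows "runs P greedy_step s (\<lambda>n t. n \<le> 45 \<and> holds_data P S t \<and>
    (\<forall>i<8. rreg t i = rreg s i) \<and> nreg t 1 = Suc (nreg s 1) \<and>
    holds_greedy P (rreg s 7) (Suc (nreg s 1)) t)"
proof -
  let ?y = "greedy P (rreg s 7) (nreg s 1)"
  have b: "0 \<le> ?y" "?y \<le> total_demand P"
    using greedy_bounds[OF P assms(2), of "nreg s 1"] by auto
  have y: "output_y s (nreg s 1) = ?y" using assms(3) by (simp add: holds_greedy_def)
  show ?thesis
    using assms b greedy_budget_nonneg[OF P assms(2) b]
    by (auto simp add: greedy_step_def runs_wp holds_data_def holds_greedy_def y Let_def
        answer_AskSup less_Suc_eq le_Suc_eq min_def simp del: answer.simps(5))
qed

lemma runs_greedy_pass: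
  assumes s: "holds_data P S s" "0 \<le> rreg s 7"
  shows "runs P greedy_pass s (\<lambda>n t. n \<le> 49 * (S + 1) + 2 \<and> holds_data P S t \<and>
    (\<forall>i<8. rreg t i = rreg s i) \<and> holds_greedy P (rreg s 7) S t)"
proof -
  let ?I = "\<lambda>k t. holds_data P S t \<and> (\<forall>i<8. rreg t i = rreg s i) \<and>
    nreg t 1 + k = S \<and> holds_greedy P (rreg s 7) (nreg t 1) t"
  let ?s = "s\<lparr>nreg := (nreg s)(1 := 0)\<rparr>"
  have "runs P (While (NLess (NReg 1) (NReg 0)) greedy_step) ?s
    (\<lambda>n t. n \<le> (S + 1) * (1 + bcost (NLess (NReg 1) (NReg 0)) + 45) \<and>
       (\<exists>k. ?I k t) \<and> \<not> bval (NLess (NReg 1) (NReg 0)) t)"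
  proof (rule runs_While[where I = ?I])
    fix k t assume I: "?I k t" and b: "bval (NLess (NReg 1) (NReg 0)) t"
    then obtain k' where k': "k = Suc k'" by (cases k) (auto simp: holds_data_def)
    have "runs P greedy_step t (\<lambda>n u. n \<le> 45 \<and> ?I k' u)"
      by (rule runs_mono[OF runs_greedy_step[of S]]) (use I s k' in auto)
    then show "\<exists>k'. k = Suc k' \<and> runs P greedy_step t (\<lambda>n u. n \<le> 45 \<and> ?I k' u)"
      using k' by blast
  next
    show "?I S ?s" using s by (auto simp: holds_data_def holds_greedy_def)
  qed
  then have "runs P (While (NLess (NReg 1) (NReg 0)) greedy_step) ?s
    (\<lambda>n t. 2 + n \<le> 49 * (S + 1) + 2 \<and> holds_data P S t \<and>
       (\<forall>i<8. rreg t i = rreg s i) \<and> holds_greedy P (rreg s 7) S t)"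
  proof (rule runs_mono)
    fix n t
    assume t: "n \<le> (S + 1) * (1 + bcost (NLess (NReg 1) (NReg 0)) + 45) \<and>
      (\<exists>k. ?I k t) \<and> \<not> bval (NLess (NReg 1) (NReg 0)) t"
    then have "nreg t 1 = S" by (auto simp: holds_data_def)
    then show "2 + n \<le> 49 * (S + 1) + 2 \<and> holds_data P S t \<and>
      (\<forall>i<8. rreg t i = rreg s i) \<and> holds_greedy P (rreg s 7) S t"
      using t by auto
  qed
  then show ?thesis by (simp add: greedy_pass_def runs_wp)
qed

lemma runs_bisection_step:
  assumes F: "\<exists>d y. feasible P S d y" and s: "bracket P S \<rho> (Suc k) s"
  shows "runs P bisection_step s (\<lambda>n t. n \<le> 49 * (S + 1) + 20 \<and> bracket P S \<rho> k t)"
proof -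
  let ?l = "(rreg s 4 + rreg s 5) / 2"
  let ?s = "s\<lparr>rreg := (rreg s)(7 := ?l)\<rparr>"
  have l: "0 \<le> ?l" using s by (simp add: bracket_def)
  have half: "rreg s 5 - ?l \<le> \<rho> * 2 ^ k" "?l - rreg s 4 \<le> \<rho> * 2 ^ k"
    using s by (auto simp: bracket_def field_simps)
  have "holds_data P S ?s" using s by (simp add: bracket_def holds_data_def)
  then have pass: "runs P greedy_pass ?s (\<lambda>n t. n \<le> 49 * (S + 1) + 2 \<and> holds_data P S t \<and>
    (\<forall>i<8. rreg t i = rreg ?s i) \<and> holds_greedy P (rreg ?s 7) S t)"
    using l by (intro runs_greedy_pass) auto
  have low: "?l \<le> OPT P S" if "greedy P ?l S < total_demand P"
    by (rule le_OPT_if_greedy_fails[OF P l F that])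
  have high: "greedy P ?l S = total_demand P" if "\<not> greedy P ?l S < total_demand P"
    using greedy_bounds[OF P l, of S] that by simp
  show ?thesis
    using s half low high
    by (auto simp: bisection_step_def runs_wp bracket_def holds_data_def holds_greedy_def
        intro!: runs_mono[OF pass])
qed

lemma runs_bisection:
  assumes F: "\<exists>d y. feasible P S d y"
    and k: "period P + rate P * capacity P \<le> \<rho> * 2 ^ k"
  shows "runs P bisection (input P S \<rho>) (\<lambda>n t. n \<le>
      (k + 1) * (49 * (S + 1) + 26) + 49 * (S + 1) + 20 \<and>
    feasible P S (output_d t) (output_y t) \<and> gmax P S (output_d t) (output_y t) \<le> OPT P S + \<rho>)"
proof -
  let ?b = "RLess (RReg 3) (RSub (RReg 5) (RReg 4))"
  let ?N = "49 * (S + 1) + 2 :: nat"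
  let ?Q = "\<lambda>t. feasible P S (output_d t) (output_y t) \<and>
    gmax P S (output_d t) (output_y t) \<le> OPT P S + \<rho>"
  (* the state in which the loop starts *)
  define s where "s = (let u = input P S \<rho> in
    u\<lparr>rreg := (rreg u)(6 := total_demand P, 5 := period P + rate P * capacity P)\<rparr>)"
  obtain d y where dy: "feasible P S d y" using F by blast
  have "bracket P S \<rho> k s"
    using k shuttle_dataD[OF P] OPT_nonneg[OF P F] greedy_large_target[OF P dy]
    by (simp add: s_def input_def Let_def bracket_def holds_data_def)
  then have "runs P (While ?b bisection_step) s
    (\<lambda>n t. n \<le> (k + 1) * (1 + bcost ?b + (?N + 18)) \<and> (\<exists>k'. bracket P S \<rho> k' t) \<and> \<not> bval ?b t)"
  proof (rule runs_While[rotated])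
    fix j t assume t: "bracket P S \<rho> j t" "bval ?b t"
    then obtain j' where "j = Suc j'" by (cases j) (auto simp: bracket_def)
    then show "\<exists>j'. j = Suc j' \<and> runs P bisection_step t (\<lambda>n u. n \<le> ?N + 18 \<and> bracket P S \<rho> j' u)"
      using runs_bisection_step[OF F, of \<rho> j' t] t by simp
  qed
  then have "runs P (While ?b bisection_step) s (\<lambda>m t. runs P greedy_pass
      (t\<lparr>rreg := (rreg t)(7 := rreg t 5)\<rparr>)
      (\<lambda>n u. m + n \<le> (k + 1) * (?N + 24) + ?N \<and> ?Q u))"
  proof (rule runs_mono)
    fix m t
    assume m: "m \<le> (k + 1) * (1 + bcost ?b + (?N + 18)) \<and> (\<exists>k'. bracket P S \<rho> k' t) \<and> \<not> bval ?b t"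
    let ?t = "t\<lparr>rreg := (rreg t)(7 := rreg t 5)\<rparr>" and ?l = "rreg t 5"
    obtain k' where br: "bracket P S \<rho> k' t" using m by blast
    have l: "0 \<le> ?l" "greedy P ?l S = total_demand P" "?l \<le> OPT P S + \<rho>"
      using m br by (auto simp: bracket_def)
    have "runs P greedy_pass ?t (\<lambda>n u. n \<le> ?N \<and> holds_data P S u \<and>
      (\<forall>i<8. rreg u i = rreg ?t i) \<and> holds_greedy P (rreg ?t 7) S u)"
      by (rule runs_greedy_pass) (use br l in \<open>auto simp: bracket_def holds_data_def\<close>)
    then show "runs P greedy_pass ?t (\<lambda>n u. m + n \<le> (k + 1) * (?N + 24) + ?N \<and> ?Q u)"
    proof (rule runs_mono)
      fix n u
      assume u: "n \<le> ?N \<and> holds_data P S u \<and> (\<forall>i<8. rreg u i = rreg ?t i) \<and>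
        holds_greedy P (rreg ?t 7) S u"
      then have "feasible P S (output_d u) (output_y u)" "gmax P S (output_d u) (output_y u) = ?l"
        using greedy_solution[OF P l(1,2), of "output_y u" "output_d u"]
        by (auto simp: holds_greedy_def)
      moreover have "m \<le> (k + 1) * (?N + 24)" using m by simp
      ultimately show "m + n \<le> (k + 1) * (?N + 24) + ?N \<and> ?Q u" using u l(3) by simp
    qed
  qed
  then show ?thesis
    using shuttle_dataD(2)[OF P]
    by (auto simp: bisection_def runs_wp input_def s_def elim!: runs_mono)
qed

end

theorem theorem1:
  shows "\<exists>prog. \<forall>P. shuttle_data P \<longrightarrow>
    (\<exists>K. \<forall>S \<rho>. 1 \<le> S \<longrightarrow> 0 < \<rho> \<longrightarrow> (\<exists>d y. feasible P S d y) \<longrightarrow>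
      (\<exists>n s. exec P prog (input P S \<rho>) n s \<and>
        real n \<le> K * time_bound S \<rho> \<and>
        feasible P S (output_d s) (output_y s) \<and>
        gmax P S (output_d s) (output_y s) \<le> OPT P S + \<rho>))"
proof (intro exI[of _ bisection] allI impI)
  fix P assume P: "shuttle_data P"
  (* M bounds the initial search interval; at least 1, so that its logarithm, which enters
     the constant of the running time, is not negative *)
  define M where "M = max 1 (period P + rate P * capacity P)"
  have M: "1 \<le> M" "period P + rate P * capacity P \<le> M" by (auto simp: M_def)
  have "\<exists>n s. exec P bisection (input P S \<rho>) n s \<and>
      real n \<le> 300 * (log 2 M + 3) * time_bound S \<rho> \<and>
      feasible P S (output_d s) (output_y s) \<and> gmax P S (output_d s) (output_y s) \<le> OPT P S + \<rho>"
    if S: "1 \<le> S" and \<rho>: "0 < \<rho>" and F: "\<exists>d y. feasible P S d y" for S \<rho>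
  proof -
    let ?L = "max 1 (log 2 (1 / \<rho>))"
    define k where "k = nat \<lceil>log 2 (M / \<rho>)\<rceil>"
    have logM: "0 \<le> log 2 M" using M by simp
    have "M / \<rho> \<le> 2 powr real k"
      using M \<rho> by (simp add: k_def real_nat_ceiling_ge flip: log_le_iff)
    then have "M \<le> \<rho> * 2 ^ k"
      using \<rho> by (simp add: powr_realpow field_simps)
    then obtain n s where run: "exec P bisection (input P S \<rho>) n s"
        "n \<le> (k + 1) * (49 * (S + 1) + 26) + 49 * (S + 1) + 20"
        "feasible P S (output_d s) (output_y s)"
        "gmax P S (output_d s) (output_y s) \<le> OPT P S + \<rho>"
      using runs_bisection[OF P F, of \<rho> k] M(2) by (auto simp: runs_def)
    have "log 2 (M / \<rho>) = log 2 M + log 2 (1 / \<rho>)"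
      using M \<rho> by (simp add: log_divide)
    then have "log 2 (M / \<rho>) \<le> log 2 M + ?L" "0 \<le> log 2 M + ?L" using logM by auto
    then have "real k \<le> log 2 M + ?L + 1" unfolding k_def by linarith
    also have "\<dots> + 1 \<le> (log 2 M + 3) * ?L"
    proof -
      have "log 2 M * 1 \<le> log 2 M * ?L" using logM by (intro mult_left_mono) auto
      then show ?thesis by (simp add: distrib_right)
    qed
    finally have k1: "real (k + 1) \<le> (log 2 M + 3) * ?L" by simp
    have "n \<le> (k + 1) * (49 * (S + 1) + 26) + (k + 1) * (49 * (S + 1) + 20)"
      using run(2) by simp
    also have "\<dots> \<le> (k + 1) * (300 * S)"
      unfolding distrib_left[symmetric] using S by (intro mult_left_mono) auto
    finally have "real n \<le> real ((k + 1) * (300 * S))" by (simp only: of_nat_le_iff)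
    also have "\<dots> = real (k + 1) * (300 * real S)" by (simp only: of_nat_mult of_nat_numeral)
    also have "\<dots> \<le> ((log 2 M + 3) * ?L) * (300 * real S)"
      using k1 by (rule mult_right_mono) simp
    finally have "real n \<le> 300 * (log 2 M + 3) * time_bound S \<rho>"
      by (simp only: time_bound_def mult_ac)
    then show ?thesis using run by blast
  qed
  then show "\<exists>K. \<forall>S \<rho>. 1 \<le> S \<longrightarrow> 0 < \<rho> \<longrightarrow> (\<exists>d y. feasible P S d y) \<longrightarrow>
      (\<exists>n s. exec P bisection (input P S \<rho>) n s \<and> real n \<le> K * time_bound S \<rho> \<and>
        feasible P S (output_d s) (output_y s) \<and>
        gmax P S (output_d s) (output_y s) \<le> OPT P S + \<rho>)"
    by blast
qed

end
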